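(* Let $X$ be a metric space, let $\Omega_1,\Omega_2\subset X$ be closed, and let $U\subset X$ with $\Omega_1\cap\Omega_2\cap U\ne\emptyset$. The pair of indicator functions $(i_{\Omega_1},i_{\Omega_2})$ is (i) firmly uniformly lower semicontinuous on $U$ if $\Omega_1\cap U$ is compact; (ii) firmly quasiuniformly lower semicontinuous on $U$ if the sets $\Omega_1\cap\operatorname{cl}V$ are compact for all $V\in EI(U)$.
   Context: $i_\Omega(x)=0$ if $x\in\Omega$ and $i_\Omega(x)=+\infty$ otherwise; $\operatorname{cl}$ is closure; $\operatorname{dom}\varphi:=\{x\mid\varphi(x)<+\infty\}$. A set $V\subset X$ is an essentially interior subset of $U$ if $\bigcup_{x\in V}B_\rho(x)\subset U$ for some $\rho>0$ ($B_\rho$ = open ball); $EI(U)$ is the collection of all such $V$. For $\varphi_1,\varphi_2\colon X\to\mathbb{R}\cup\{+\infty\}$, $x_1\in\operatorname{dom}\varphi_1$, $x_2\in\operatorname{dom}\varphi_2$ put $$(\varphi_1\diamondsuit\varphi_2)_U(x_1,x_2):=\inf_{x\in U}\max\{d(x,x_1),\,d(x,x_2),\,(\varphi_1+\varphi_2)(x)-\varphi_1(x_1)-\varphi_2(x_2)\},$$ $$\Theta_U^\circ(\varphi_1,\varphi_2):=\limsup_{\substack{d(x_1,x_2)\to0\\ x_1\in\operatorname{dom}\varphi_1\cap U,\,x_2\in\operatorname{dom}\varphi_2\cap U}}(\varphi_1\diamondsuit\varphi_2)_U(x_1,x_2),\quad \Theta_U^\dagger(\varphi_1,\varphi_2):=\sup_{V\in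 EI(U)}\ \limsup_{\substack{d(x_1,x_2)\to0\\ x_1\in\operatorname{dom}\varphi_1\cap V,\,x_2\in\operatorname{dom}\varphi_2\cap V}}(\varphi_1\diamondsuit\varphi_2)_U(x_1,x_2),$$ where each limsup is $\lim_{\eta\downarrow0}$ of the supremum over the indicated pairs with $d(x_1,x_2)<\eta$, and the supremum over an empty set is $0$. The pair is firmly uniformly lower semicontinuous on $U$ if $\Theta_U^\circ(\varphi_1,\varphi_2)=0$, and firmly quasiuniformly lower semicontinuous on $U$ if $\Theta_U^\dagger(\varphi_1,\varphi_2)=0$. *)

theory Defs
  imports "HOL-Analysis.Analysis"
begin

text \<open>Functions into the reals extended by plus infinity are rendered as functions into
  \<^typ>\<open>ereal\<close>; the value minus infinity is never taken by the functions considered.\<close>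

definition ind_fun :: "'a set \<Rightarrow> 'a \<Rightarrow> ereal" where
  "ind_fun \<Omega> x = (if x \<in> \<Omega> then 0 else \<infinity>)"

definition edom :: "('a \<Rightarrow> ereal) \<Rightarrow> 'a set" where
  "edom \<phi> = {x. \<phi> x < \<infinity>}"

definition EI :: "'a::metric_space set \<Rightarrow> 'a set set" where
  "EI U = {V. \<exists>\<rho>>0. (\<Union>x\<in>V. ball x \<rho>) \<subseteq> U}"

definition diamond ::
    "('a::metric_space \<Rightarrow> ereal) \<Rightarrow> ('a \<Rightarrow> ereal) \<Rightarrow> 'a set \<Rightarrow> 'a \<Rightarrow> 'a \<Rightarrow> ereal" where
  "diamond \<phi>\<^sub>1 \<phi>\<^sub>2 U x\<^sub>1 x\<^sub>2 =
     (INF x\<in>U. max (ereal (dist x x\<^sub>1))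
                (max (ereal (dist x x\<^sub>2)) (\<phi>\<^sub>1 x + \<phi>\<^sub>2 x - \<phi>\<^sub>1 x\<^sub>1 - \<phi>\<^sub>2 x\<^sub>2)))"

text \<open>All quantities whose supremum is taken are nonnegative, hence the convention that the
  supremum over the empty set is 0 (in \<^typ>\<open>ereal\<close> the library value is minus infinity).\<close>

definition sup0 :: "'b set \<Rightarrow> ('b \<Rightarrow> ereal) \<Rightarrow> ereal" where
  "sup0 A f = (if A = {} then 0 else (SUP a\<in>A. f a))"

definition close_pairs ::
    "('a::metric_space \<Rightarrow> ereal) \<Rightarrow> ('a \<Rightarrow> ereal) \<Rightarrow> 'a set \<Rightarrow> real \<Rightarrow> ('a \<times> 'a) set" where
  "close_pairs \<phi>\<^sub>1 \<phi>\<^sub>2 W \<eta> =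
     {(x\<^sub>1, x\<^sub>2). x\<^sub>1 \<in> edom \<phi>\<^sub>1 \<inter> W \<and> x\<^sub>2 \<in> edom \<phi>\<^sub>2 \<inter> W \<and> dist x\<^sub>1 x\<^sub>2 < \<eta>}"

text \<open>The limsup over pairs in \<open>W\<close>, of the diamond taken relative to \<open>U\<close>. The limit exists, as
  shown in \<open>limsup_pairs_tendsto\<close> below.\<close>

definition limsup_pairs ::
    "('a::metric_space \<Rightarrow> ereal) \<Rightarrow> ('a \<Rightarrow> ereal) \<Rightarrow> 'a set \<Rightarrow> 'a set \<Rightarrow> ereal" where
  "limsup_pairs \<phi>\<^sub>1 \<phi>\<^sub>2 U W =
     Lim (at_right (0::real))
       (\<lambda>\<eta>. sup0 (close_pairs \<phi>\<^sub>1 \<phi>\<^sub>2 W \<eta>) (\<lambda>(x\<^sub>1, x\<^sub>2). diamond \<phi>\<^sub>1 \<phi>\<^sub>2 U x\<^sub>1 x\<^sub>2))"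

definition Theta_circ ::
    "('a::metric_space \<Rightarrow> ereal) \<Rightarrow> ('a \<Rightarrow> ereal) \<Rightarrow> 'a set \<Rightarrow> ereal" where
  "Theta_circ \<phi>\<^sub>1 \<phi>\<^sub>2 U = limsup_pairs \<phi>\<^sub>1 \<phi>\<^sub>2 U U"

definition Theta_dagger ::
    "('a::metric_space \<Rightarrow> ereal) \<Rightarrow> ('a \<Rightarrow> ereal) \<Rightarrow> 'a set \<Rightarrow> ereal" where
  "Theta_dagger \<phi>\<^sub>1 \<phi>\<^sub>2 U = sup0 (EI U) (\<lambda>V. limsup_pairs \<phi>\<^sub>1 \<phi>\<^sub>2 U V)"

definition firmly_uniformly_lsc ::
    "('a::metric_space \<Rightarrow> ereal) \<Rightarrow> ('a \<Rightarrow> ereal) \<Rightarrow> 'a set \<Rightarrow> bool" where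
  "firmly_uniformly_lsc \<phi>\<^sub>1 \<phi>\<^sub>2 U \<longleftrightarrow> Theta_circ \<phi>\<^sub>1 \<phi>\<^sub>2 U = 0"

definition firmly_quasiuniformly_lsc ::
    "('a::metric_space \<Rightarrow> ereal) \<Rightarrow> ('a \<Rightarrow> ereal) \<Rightarrow> 'a set \<Rightarrow> bool" where
  "firmly_quasiuniformly_lsc \<phi>\<^sub>1 \<phi>\<^sub>2 U \<longleftrightarrow> Theta_dagger \<phi>\<^sub>1 \<phi>\<^sub>2 U = 0"

lemma diamond_nonneg: "0 \<le> diamond \<phi>\<^sub>1 \<phi>\<^sub>2 U x\<^sub>1 x\<^sub>2"
  unfolding diamond_def by (intro INF_greatest) (simp add: le_max_iff_disj)

lemma sup0_mono:
  assumes "A \<subseteq> B" and "\<And>b. b \<in> B \<Longrightarrow> 0 \<le> f b"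
  shows "sup0 A f \<le> sup0 B f"
proof (cases "A = {}")
  case True
  show ?thesis
  proof (cases "B = {}")
    case False
    then obtain b where "b \<in> B" by blast
    then have "0 \<le> (SUP b\<in>B. f b)" using assms(2) by (blast intro: SUP_upper2)
    then show ?thesis using True False by (simp add: sup0_def)
  qed (simp add: True)
next
  case False
  then show ?thesis using assms(1) by (auto simp: sup0_def intro: SUP_subset_mono)
qed

lemma limsup_pairs_tendsto:
  "((\<lambda>\<eta>. sup0 (close_pairs \<phi>\<^sub>1 \<phi>\<^sub>2 W \<eta>) (\<lambda>(x\<^sub>1, x\<^sub>2). diamond \<phi>\<^sub>1 \<phi>\<^sub>2 U x\<^sub>1 x\<^sub>2))
     \<longlongrightarrow> limsup_pairs \<phi>\<^sub>1 \<phi>\<^sub>2 U W) (at_right 0)"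
proof -
  let ?f = "\<lambda>\<eta>. sup0 (close_pairs \<phi>\<^sub>1 \<phi>\<^sub>2 W \<eta>) (\<lambda>(x\<^sub>1, x\<^sub>2). diamond \<phi>\<^sub>1 \<phi>\<^sub>2 U x\<^sub>1 x\<^sub>2)"
  have mono: "?f \<eta> \<le> ?f \<eta>'" if "\<eta> \<le> \<eta>'" for \<eta> \<eta>'
    by (rule sup0_mono) (use that in \<open>auto simp: close_pairs_def diamond_nonneg\<close>)
  have "(?f \<longlongrightarrow> (INF \<eta>\<in>{0<..}. ?f \<eta>)) (at_right 0)"
  proof (rule order_tendstoI)
    fix a assume a: "a < (INF \<eta>\<in>{0<..}. ?f \<eta>)"
    show "\<forall>\<^sub>F \<eta> in at_right 0. a < ?f \<eta>"
      using eventually_at_right_less[of "0::real"]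
      by eventually_elim (rule less_le_trans[OF a INF_lower], simp)
  next
    fix a assume "(INF \<eta>\<in>{0<..}. ?f \<eta>) < a"
    then obtain \<eta>\<^sub>0 where "\<eta>\<^sub>0 > 0" "?f \<eta>\<^sub>0 < a" by (auto simp: INF_less_iff)
    show "\<forall>\<^sub>F \<eta> in at_right 0. ?f \<eta> < a"
      unfolding eventually_at_right_field
    proof (intro exI[of _ \<eta>\<^sub>0] conjI allI impI)
      fix y assume "0 < y" "y < \<eta>\<^sub>0"
      then show "?f y < a"
        using mono[of y \<eta>\<^sub>0] \<open>?f \<eta>\<^sub>0 < a\<close> by (meson le_less_trans less_imp_le)
    qed (fact \<open>\<eta>\<^sub>0 > 0\<close>)
  qed
  then show ?thesis
    unfolding limsup_pairs_def by (simp add: tendsto_Lim)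
qed

end

theory Submission
  imports Defs
begin

text \<open>For indicator functions the third term of the maximum defining
  \<open>diamond\<close> vanishes at every common point of \<open>\<Omega>\<^sub>1\<close> and \<open>\<Omega>\<^sub>2\<close>, so the diamond at \<open>(x\<^sub>1, x\<^sub>2)\<close> is
  bounded by the larger distance from \<open>x\<^sub>1\<close>, \<open>x\<^sub>2\<close> to any single point of \<open>\<Omega>\<^sub>1 \<inter> \<Omega>\<^sub>2 \<inter> U\<close>
  (\<open>diamond_ind_fun_le\<close>). Both claims thus ask for a point of \<open>\<Omega>\<^sub>1 \<inter> \<Omega>\<^sub>2 \<inter> U\<close> uniformly close to
  every pair \<open>x\<^sub>1 \<in> \<Omega>\<^sub>1\<close>, \<open>x\<^sub>2 \<in> \<Omega>\<^sub>2\<close> with small mutual distance.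

  Compactness provides this point (\<open>compact_closed_common_point\<close>): if the \<open>x\<^sub>1\<close> range over a compact
  set \<open>K\<close>, then pairs with mutual distance tending to 0 have a common cluster point, which lies in
  \<open>K\<close> and in the closed set \<open>\<Omega>\<^sub>2\<close>. It is admissible in the infimum as soon as \<open>K \<subseteq> \<Omega>\<^sub>1 \<inter> U\<close>. For
  the uniform notion \<open>K = \<Omega>\<^sub>1 \<inter> U\<close>; for the quasiuniform one \<open>K = \<Omega>\<^sub>1 \<inter> closure V\<close>, which is
  contained in \<open>U\<close> because \<open>U\<close> contains a uniform neighbourhood of \<open>V\<close>
  (\<open>closure_EI_subset\<close>).\<close>

lemma sup0_nonneg:
  assumes "\<And>a. a \<in> A \<Longrightarrow> 0 \<le> f a"
  shows "0 \<le> sup0 A f"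
  using sup0_mono[of "{}" A f] assms by (simp add: sup0_def)

lemma sup0_le:
  assumes "0 \<le> c" and "\<And>a. a \<in> A \<Longrightarrow> f a \<le> c"
  shows "sup0 A f \<le> c"
  using assms by (auto simp: sup0_def intro: SUP_least)

lemma limsup_pairs_eq_0I:
  assumes "\<And>\<epsilon>::real. \<epsilon> > 0 \<Longrightarrow>
    \<exists>\<eta>>0. \<forall>(x\<^sub>1, x\<^sub>2) \<in> close_pairs \<phi>\<^sub>1 \<phi>\<^sub>2 W \<eta>. diamond \<phi>\<^sub>1 \<phi>\<^sub>2 U x\<^sub>1 x\<^sub>2 \<le> ereal \<epsilon>"
  shows "limsup_pairs \<phi>\<^sub>1 \<phi>\<^sub>2 U W = 0"
proof (rule antisym)
  let ?f = "\<lambda>\<eta>. sup0 (close_pairs \<phi>\<^sub>1 \<phi>\<^sub>2 W \<eta>) (\<lambda>(x\<^sub>1, x\<^sub>2). diamond \<phi>\<^sub>1 \<phi>\<^sub>2 U x\<^sub>1 x\<^sub>2)"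
  note lim = limsup_pairs_tendsto[of \<phi>\<^sub>1 \<phi>\<^sub>2 W U]
  have "0 \<le> ?f \<eta>" for \<eta>
    by (rule sup0_nonneg) (auto simp: diamond_nonneg)
  then show "0 \<le> limsup_pairs \<phi>\<^sub>1 \<phi>\<^sub>2 U W"
    by (intro tendsto_lowerbound[OF lim]) (auto simp: trivial_limit_at_right_real)
  have "limsup_pairs \<phi>\<^sub>1 \<phi>\<^sub>2 U W \<le> 0 + ereal \<epsilon>" if "\<epsilon> > 0" for \<epsilon>
  proof -
    obtain \<eta>\<^sub>0 where "\<eta>\<^sub>0 > 0" and bound:
      "\<And>x\<^sub>1 x\<^sub>2. (x\<^sub>1, x\<^sub>2) \<in> close_pairs \<phi>\<^sub>1 \<phi>\<^sub>2 W \<eta>\<^sub>0 \<Longrightarrow> diamond \<phi>\<^sub>1 \<phi>\<^sub>2 U x\<^sub>1 x\<^sub>2 \<le> ereal \<epsilon>"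
      using assms[OF \<open>\<epsilon> > 0\<close>] by fast
    have "?f \<eta> \<le> ereal \<epsilon>" if "\<eta> < \<eta>\<^sub>0" for \<eta>
    proof (rule sup0_le)
      show "0 \<le> ereal \<epsilon>" using \<open>\<epsilon> > 0\<close> by simp
    qed (use that in \<open>auto simp: close_pairs_def intro!: bound\<close>)
    then have "\<forall>\<^sub>F \<eta> in at_right 0. ?f \<eta> \<le> ereal \<epsilon>"
      using \<open>\<eta>\<^sub>0 > 0\<close> unfolding eventually_at_right_field by blast
    from tendsto_upperbound[OF lim this] show ?thesis
      by (simp add: trivial_limit_at_right_real)
  qed
  then show "limsup_pairs \<phi>\<^sub>1 \<phi>\<^sub>2 U W \<le> 0"
    by (rule ereal_le_epsilon2)
qed

lemma edom_ind_fun [simp]: "edom (ind_fun \<Omega>) = \<Omega>"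
  by (auto simp: edom_def ind_fun_def)

lemma diamond_ind_fun_le:
  assumes "x \<in> \<Omega>\<^sub>1 \<inter> \<Omega>\<^sub>2 \<inter> U" and "x\<^sub>1 \<in> \<Omega>\<^sub>1" and "x\<^sub>2 \<in> \<Omega>\<^sub>2"
  shows "diamond (ind_fun \<Omega>\<^sub>1) (ind_fun \<Omega>\<^sub>2) U x\<^sub>1 x\<^sub>2 \<le> ereal (max (dist x x\<^sub>1) (dist x x\<^sub>2))"
  unfolding diamond_def using assms
  by (intro INF_lower2[of x]) (auto simp: ind_fun_def max_def)

text \<open>If no threshold \<open>\<eta>\<close> worked for \<open>\<epsilon>\<close>, there would be pairs at distance less than \<open>1/(n+1)\<close>
  without a nearby common point; the limit of a convergent subsequence is one.\<close>

lemma compact_closed_common_point: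
  fixes K C :: "'a::metric_space set"
  assumes "compact K" and "closed C" and "\<epsilon> > 0"
  shows "\<exists>\<eta>>0. \<forall>x\<in>K. \<forall>y\<in>C. dist x y < \<eta> \<longrightarrow> (\<exists>z\<in>K \<inter> C. dist z x < \<epsilon> \<and> dist z y < \<epsilon>)"
proof (rule ccontr)
  assume contra: "\<not> ?thesis"
  have "\<exists>x y. x \<in> K \<and> y \<in> C \<and> dist x y < inverse (real (Suc n)) \<and>
      (\<forall>z\<in>K \<inter> C. \<not> (dist z x < \<epsilon> \<and> dist z y < \<epsilon>))" for n
  proof -
    have "inverse (real (Suc n)) > 0" by simp
    with contra show ?thesis by blast
  qed
  then obtain x y where xy: "\<And>n. x n \<in> K" "\<And>n. y n \<in> C"
      "\<And>n. dist (x n) (y n) < inverse (real (Suc n))"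
    and far: "\<And>n z. z \<in> K \<inter> C \<Longrightarrow> \<not> (dist z (x n) < \<epsilon> \<and> dist z (y n) < \<epsilon>)"
    by metis
  obtain z r where "z \<in> K" "strict_mono r" and xz: "(x \<circ> r) \<longlonglongrightarrow> z"
    using \<open>compact K\<close> xy(1) unfolding compact_def by blast
  have "(\<lambda>n. inverse (real (Suc (r n)))) \<longlonglongrightarrow> 0"
    using LIMSEQ_subseq_LIMSEQ[OF LIMSEQ_inverse_real_of_nat \<open>strict_mono r\<close>]
    by (simp only: o_def)
  moreover have "(\<lambda>n. dist ((x \<circ> r) n) z) \<longlonglongrightarrow> 0"
    by (rule iffD1[OF tendsto_dist_iff xz])
  ultimately have sum0: "(\<lambda>n. inverse (real (Suc (r n))) + dist ((x \<circ> r) n) z) \<longlonglongrightarrow> 0"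
    by (rule tendsto_add_zero)
  have "dist ((y \<circ> r) n) z \<le> inverse (real (Suc (r n))) + dist ((x \<circ> r) n) z" for n
    using xy(3)[of "r n"] dist_triangle3[of "y (r n)" z "x (r n)"] unfolding o_apply by linarith
  then have "(\<lambda>n. dist ((y \<circ> r) n) z) \<longlonglongrightarrow> 0"
    by (intro tendsto_sandwich[OF _ _ tendsto_const sum0] always_eventually allI zero_le_dist)
  then have yz: "(y \<circ> r) \<longlonglongrightarrow> z"
    by (rule iffD2[OF tendsto_dist_iff])
  have "z \<in> C"
    by (rule closed_sequentially[OF \<open>closed C\<close> _ yz]) (simp add: xy(2))
  have "\<forall>\<^sub>F n in sequentially. dist ((x \<circ> r) n) z < \<epsilon> \<and> dist ((y \<circ> r) n) z < \<epsilon>"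
    using tendstoD[OF xz \<open>\<epsilon> > 0\<close>] tendstoD[OF yz \<open>\<epsilon> > 0\<close>] by eventually_elim simp
  then obtain n where "dist ((x \<circ> r) n) z < \<epsilon>" "dist ((y \<circ> r) n) z < \<epsilon>"
    using eventually_happens' sequentially_bot by blast
  then show False
    using far[of z "r n"] \<open>z \<in> K\<close> \<open>z \<in> C\<close> by (simp add: dist_commute)
qed

text \<open>Pairs are drawn from \<open>W\<close> while the infimum runs over \<open>U\<close>; the set \<open>K\<close> mediates between the
  two, so that the uniform and the quasiuniform case are both instances.\<close>

lemma limsup_pairs_ind_fun_eq_0:
  assumes "compact K" and "closed \<Omega>\<^sub>2" and "\<Omega>\<^sub>1 \<inter> W \<subseteq> K" and "K \<subseteq> \<Omega>\<^sub>1 \<inter> U"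
  shows "limsup_pairs (ind_fun \<Omega>\<^sub>1) (ind_fun \<Omega>\<^sub>2) U W = 0"
proof (rule limsup_pairs_eq_0I)
  fix \<epsilon> :: real assume "\<epsilon> > 0"
  then obtain \<eta> where "\<eta> > 0" and near:
    "\<And>x y. x \<in> K \<Longrightarrow> y \<in> \<Omega>\<^sub>2 \<Longrightarrow> dist x y < \<eta> \<Longrightarrow> \<exists>z\<in>K \<inter> \<Omega>\<^sub>2. dist z x < \<epsilon> \<and> dist z y < \<epsilon>"
    using compact_closed_common_point[OF assms(1,2)] by metis
  have "diamond (ind_fun \<Omega>\<^sub>1) (ind_fun \<Omega>\<^sub>2) U x\<^sub>1 x\<^sub>2 \<le> ereal \<epsilon>"
    if "(x\<^sub>1, x\<^sub>2) \<in> close_pairs (ind_fun \<Omega>\<^sub>1) (ind_fun \<Omega>\<^sub>2) W \<eta>" for x\<^sub>1 x\<^sub>2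
  proof -
    have x: "x\<^sub>1 \<in> \<Omega>\<^sub>1" "x\<^sub>1 \<in> W" "x\<^sub>2 \<in> \<Omega>\<^sub>2" "dist x\<^sub>1 x\<^sub>2 < \<eta>"
      using that by (auto simp: close_pairs_def)
    then obtain z where z: "z \<in> K \<inter> \<Omega>\<^sub>2" "dist z x\<^sub>1 < \<epsilon>" "dist z x\<^sub>2 < \<epsilon>"
      using near[of x\<^sub>1 x\<^sub>2] assms(3) by blast
    then have "z \<in> \<Omega>\<^sub>1 \<inter> \<Omega>\<^sub>2 \<inter> U" using assms(4) by blast
    from diamond_ind_fun_le[OF this x(1,3)]
    have "diamond (ind_fun \<Omega>\<^sub>1) (ind_fun \<Omega>\<^sub>2) U x\<^sub>1 x\<^sub>2 \<le> ereal (max (dist z x\<^sub>1) (dist z x\<^sub>2))" .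
    also have "\<dots> \<le> ereal \<epsilon>" using z by simp
    finally show ?thesis .
  qed
  with \<open>\<eta> > 0\<close> show "\<exists>\<eta>>0. \<forall>(x\<^sub>1, x\<^sub>2) \<in> close_pairs (ind_fun \<Omega>\<^sub>1) (ind_fun \<Omega>\<^sub>2) W \<eta>.
      diamond (ind_fun \<Omega>\<^sub>1) (ind_fun \<Omega>\<^sub>2) U x\<^sub>1 x\<^sub>2 \<le> ereal \<epsilon>" by blast
qed

lemma closure_EI_subset:
  assumes "V \<in> EI U"
  shows "closure V \<subseteq> U"
proof
  fix y assume "y \<in> closure V"
  obtain \<rho> where "\<rho> > 0" and sub: "(\<Union>x\<in>V. ball x \<rho>) \<subseteq> U"
    using assms by (auto simp: EI_def)
  then obtain x where "x \<in> V" "dist x y < \<rho>"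
    using \<open>y \<in> closure V\<close> by (auto simp: closure_approachable)
  then have "y \<in> (\<Union>x\<in>V. ball x \<rho>)" by auto
  with sub show "y \<in> U" by blast
qed

theorem proposition5p11:
  fixes \<Omega>\<^sub>1 \<Omega>\<^sub>2 U :: "'a::metric_space set"
  assumes "closed \<Omega>\<^sub>1" and "closed \<Omega>\<^sub>2" and "\<Omega>\<^sub>1 \<inter> \<Omega>\<^sub>2 \<inter> U \<noteq> {}"
  shows "(compact (\<Omega>\<^sub>1 \<inter> U) \<longrightarrow> firmly_uniformly_lsc (ind_fun \<Omega>\<^sub>1) (ind_fun \<Omega>\<^sub>2) U) \<and>
         ((\<forall>V\<in>EI U. compact (\<Omega>\<^sub>1 \<inter> closure V)) \<longrightarrow>
            firmly_quasiuniformly_lsc (ind_fun \<Omega>\<^sub>1) (ind_fun \<Omega>\<^sub>2) U)"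
proof (intro conjI impI)
  assume "compact (\<Omega>\<^sub>1 \<inter> U)"
  then show "firmly_uniformly_lsc (ind_fun \<Omega>\<^sub>1) (ind_fun \<Omega>\<^sub>2) U"
    unfolding firmly_uniformly_lsc_def Theta_circ_def
    using assms(2) by (intro limsup_pairs_ind_fun_eq_0[of "\<Omega>\<^sub>1 \<inter> U"]) auto
next
  assume cpt: "\<forall>V\<in>EI U. compact (\<Omega>\<^sub>1 \<inter> closure V)"
  have "limsup_pairs (ind_fun \<Omega>\<^sub>1) (ind_fun \<Omega>\<^sub>2) U V = 0" if "V \<in> EI U" for V
  proof (rule limsup_pairs_ind_fun_eq_0[of "\<Omega>\<^sub>1 \<inter> closure V"])
    show "\<Omega>\<^sub>1 \<inter> V \<subseteq> \<Omega>\<^sub>1 \<inter> closure V" using closure_subset by blast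
    show "\<Omega>\<^sub>1 \<inter> closure V \<subseteq> \<Omega>\<^sub>1 \<inter> U" using closure_EI_subset[OF that] by blast
  qed (use cpt that assms(2) in auto)
  then show "firmly_quasiuniformly_lsc (ind_fun \<Omega>\<^sub>1) (ind_fun \<Omega>\<^sub>2) U"
    unfolding firmly_quasiuniformly_lsc_def Theta_dagger_def
    by (intro antisym sup0_le sup0_nonneg) auto
qed

end
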